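(* Let $C$ be a polyhedral convex set in a finite-dimensional Euclidean space $\mathbb{X}$. Suppose that $g$ is either the indicator function $\delta_C$ or the support function $\sigma_C$ of $C$. Let $(\bar x,\bar z)\in\operatorname{gph}\partial g$ and $L:=\operatorname{par}\partial g^*(\bar z)$. Then $$L^\perp\times L\subset N_{\operatorname{gph}\partial g}(\bar x,\bar z).$$ Moreover, $$L\times L^\perp\in\mathcal{S}\partial g(\bar x,\bar z),$$ where $\mathcal{S}\partial g$ is the SC (subspace containing) derivative of the subdifferential mapping $\partial g$.
   Context: $\delta_C(x)=0$ if $x\in C$ and $+\infty$ otherwise; $\sigma_C(v)=\sup_{x\in C}\langle v,x\rangle$. $\partial g$ is the convex subdifferential, $\operatorname{gph}\partial g=\{(x,z)\mid z\in\partial g(x)\}$, and $g^*$ is the Legendre–Fenchel conjugate. For a nonempty convex set $D$, $\operatorname{par}D:=\operatorname{span}(D-x)$ for any $x\in D$. $L^\perp$ is the orthogonal complement of $L$. Limiting normal cone. For a closed set $\Omega$ and $\bar u\in\Omega$, the regular normal cone is $\widehat N_\Omega(\bar u):=\{v\mid\limsup_{u\to\bar u,\,u\in\Omega}\frac{\langle v,u-\bar u\rangle}{\|u-\bar u\|}\le0\}$, and the limiting normal cone $N_\Omega(\bar u)$ is the set of all $v$ for which there exist $u_k\to\bar u$, $u_k\in\Omega$, and $v_k\to v$ with $v_k\in\widehat N_\Omega(u_k)$ for all $k$. SC derivative. Let $n=\dim\mathbb{X}$ and let $\mathcal{Z}_n$ be the set of all $n$-dimensional linear subspaces of $\mathbb{X}\times\mathbb{X}$,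 with the metric $d(L_1,L_2)=\|P_{L_1}-P_{L_2}\|$, where $P_{L_i}$ is the orthogonal projection onto $L_i$. For a set-valued mapping $F:\mathbb{X}\rightrightarrows\mathbb{X}$, let $\mathcal{O}_F$ be the set of points $(x,y)\in\operatorname{gph}F$ at which the (Bouligand) tangent cone $T_{\operatorname{gph}F}(x,y)$ belongs to $\mathcal{Z}_n$. Then $\mathcal{S}F(\bar x,\bar y)$ is the set of all $S\in\mathcal{Z}_n$ for which there exist $(x_k,y_k)\in\mathcal{O}_F$ with $(x_k,y_k)\to(\bar x,\bar y)$ and $d\big(T_{\operatorname{gph}F}(x_k,y_k),S\big)\to0$. *)

theory Defs
  imports "HOL-Analysis.Analysis"
begin

section \<open>Convex analysis with extended-real-valued functions\<close>

definition indicator_fun :: "'a set \<Rightarrow> 'a \<Rightarrow> ereal" where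
  "indicator_fun C x = (if x \<in> C then 0 else \<infinity>)"

definition support_fun :: "'a::real_inner set \<Rightarrow> 'a \<Rightarrow> ereal" where
  "support_fun C v = (SUP x\<in>C. ereal (v \<bullet> x))"

text \<open>As usual, the subdifferential is empty at points where the function is not finite.\<close>

definition subdifferential :: "('a::real_inner \<Rightarrow> ereal) \<Rightarrow> 'a \<Rightarrow> 'a set" where
  "subdifferential g x =
     {z. \<bar>g x\<bar> \<noteq> \<infinity> \<and> (\<forall>y. g x + ereal (z \<bullet> (y - x)) \<le> g y)}"

definition conjugate :: "('a::real_inner \<Rightarrow> ereal) \<Rightarrow> 'a \<Rightarrow> ereal" where
  "conjugate g v = (SUP x. ereal (v \<bullet> x) - g x)"

definition gph :: "('a \<Rightarrow> 'b set) \<Rightarrow> ('a \<times> 'b) set" where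
  "gph F = {(x, y). y \<in> F x}"

text \<open>The choice of the base point is immaterial, see \<open>par_eq\<close> below.\<close>

definition par :: "'a::real_vector set \<Rightarrow> 'a set" where
  "par D = span ((\<lambda>y. y - (SOME x. x \<in> D)) ` D)"

lemma par_eq:
  assumes "x \<in> D"
  shows "par D = span ((\<lambda>y. y - x) ` D)"
proof -
  have *: "span ((\<lambda>y. y - a) ` D) \<subseteq> span ((\<lambda>y. y - b) ` D)"
    if "a \<in> D" "b \<in> D" for a b
  proof (rule span_minimal)
    have "y - a = (y - b) - (a - b)" for y by simp
    then show "(\<lambda>y. y - a) ` D \<subseteq> span ((\<lambda>y. y - b) ` D)"
      using that by (metis (no_types, lifting) image_subsetI image_eqI span_base span_diff)
  qed simp
  have "(SOME x. x \<in> D) \<in> D" using assms by (rule someI)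
  with * assms show ?thesis unfolding par_def by blast
qed

section \<open>Tangent and normal cones\<close>

definition tangent_cone :: "'a::real_normed_vector set \<Rightarrow> 'a \<Rightarrow> 'a set" where
  "tangent_cone \<Omega> u =
     {w. \<exists>t w'. (\<forall>k. t k > 0) \<and> t \<longlonglongrightarrow> (0::real) \<and> w' \<longlonglongrightarrow> w \<and>
            (\<forall>k::nat. u + t k *\<^sub>R w' k \<in> \<Omega>)}"

text \<open>
  The filter \<open>at u within \<Omega>\<close> excludes \<open>u\<close>; at an isolated point of \<open>\<Omega>\<close> it is trivial,
  the upper limit is \<open>-\<infinity>\<close>, and the cone is the whole space.
\<close>

definition regular_normal_cone :: "'a::real_inner set \<Rightarrow> 'a \<Rightarrow> 'a set" where
  "regular_normal_cone \<Omega> u =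
     {v. Limsup (at u within \<Omega>) (\<lambda>u'. ereal (v \<bullet> (u' - u) / norm (u' - u))) \<le> 0}"

definition limiting_normal_cone :: "'a::real_inner set \<Rightarrow> 'a \<Rightarrow> 'a set" where
  "limiting_normal_cone \<Omega> u =
     {v. \<exists>u' v'. (\<forall>k::nat. u' k \<in> \<Omega> \<and> v' k \<in> regular_normal_cone \<Omega> (u' k)) \<and>
            u' \<longlonglongrightarrow> u \<and> v' \<longlonglongrightarrow> v}"

section \<open>The subspace containing derivative\<close>

definition orth_proj :: "'a::euclidean_space set \<Rightarrow> 'a \<Rightarrow> 'a" where
  "orth_proj L x = (THE y. y \<in> L \<and> x - y \<in> L\<^sup>\<bottom>)"

lemma orth_proj:
  assumes "subspace L"
  shows "orth_proj L x \<in> L \<and> x - orth_proj L x \<in> L\<^sup>\<bottom>"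
  unfolding orth_proj_def
proof (rule theI')
  obtain y z where yz: "y \<in> span L" "\<And>w. w \<in> span L \<Longrightarrow> orthogonal z w" "x = y + z"
    using orthogonal_subspace_decomp_exists[of L x] by metis
  have sp: "span L = L" using assms by (simp add: span_eq_iff)
  show "\<exists>!y. y \<in> L \<and> x - y \<in> L\<^sup>\<bottom>"
  proof (rule ex1I[of _ y])
    show "y \<in> L \<and> x - y \<in> L\<^sup>\<bottom>"
      using yz by (auto simp: sp orthogonal_comp_def orthogonal_commute)
  next
    fix y' assume y': "y' \<in> L \<and> x - y' \<in> L\<^sup>\<bottom>"
    have d: "y' - y \<in> L" using y' yz assms by (simp add: sp subspace_diff)
    have "(y' - y) \<bullet> (x - y) = 0"
      using yz(2)[of "y' - y"] yz(3) d by (simp add: sp orthogonal_def inner_commute)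
    moreover have "(y' - y) \<bullet> (x - y') = 0"
      using y' d by (simp add: orthogonal_comp_def orthogonal_def)
    ultimately have "(y' - y) \<bullet> (y' - y) = 0"
      by (simp add: inner_diff_right)
    then show "y' = y" by simp
  qed
qed

definition subspace_dist :: "'a::euclidean_space set \<Rightarrow> 'a set \<Rightarrow> real" where
  "subspace_dist L1 L2 = onorm (\<lambda>x. orth_proj L1 x - orth_proj L2 x)"

definition half_dim_subspaces :: "('a::euclidean_space \<times> 'a) set set" where
  "half_dim_subspaces = {S. subspace S \<and> dim S = DIM('a)}"

definition smooth_points :: "('a::euclidean_space \<Rightarrow> 'a set) \<Rightarrow> ('a \<times> 'a) set" where
  "smooth_points F = {p \<in> gph F. tangent_cone (gph F) p \<in> half_dim_subspaces}"

definition SC_derivative ::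
  "('a::euclidean_space \<Rightarrow> 'a set) \<Rightarrow> 'a \<Rightarrow> 'a \<Rightarrow> ('a \<times> 'a) set set" where
  "SC_derivative F x y =
     {S \<in> half_dim_subspaces. \<exists>p. (\<forall>k::nat. p k \<in> smooth_points F) \<and> p \<longlonglongrightarrow> (x, y) \<and>
        (\<lambda>k. subspace_dist (tangent_cone (gph F) (p k)) S) \<longlonglongrightarrow> 0}"

end

theory Submission
  imports Defs
begin

text \<open>
  Both graphs are described by the normal cone mapping
  \<open>N\<^sub>C(c) = {v. \<forall>y\<in>C. v \<bullet> (y - c) \<le> 0}\<close> of \<open>C\<close>: the graph of \<open>\<partial>\<delta>\<^sub>C\<close> is the graph of \<open>N\<^sub>C\<close>, and
  the graph of \<open>\<partial>\<sigma>\<^sub>C\<close> is its inverse.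

  The proof rests on a local description of this graph (\<open>normal_cone_graph_flat\<close>). Let \<open>C\<close> be
  polyhedral, \<open>c \<in> C\<close>, \<open>M = span N\<^sub>C(c)\<close>, and let \<open>v\<close> lie in the relative interior of \<open>N\<^sub>C(c)\<close>
  (strict complementarity). Then near \<open>(c, v)\<close> the graph of \<open>N\<^sub>C\<close> coincides with the affine
  subspace \<open>(c, v) + M\<^sup>\<bottom> \<times> M\<close>. At such a point the tangent cone is \<open>M\<^sup>\<bottom> \<times> M\<close>, and the regular
  normal cone contains \<open>(M\<^sup>\<bottom> \<times> M)\<^sup>\<bottom> = M \<times> M\<^sup>\<bottom>\<close>. Both claims follow once the reference point is a
  limit of points of this kind for which \<open>M\<close> is one fixed, correct subspace
  (\<open>flat_sequence_conclusions\<close>).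

  For \<open>g = \<sigma>\<^sub>C\<close> one has \<open>\<partial>g\<^sup>*(z) = N\<^sub>C(z)\<close>, so that \<open>L = span N\<^sub>C(z)\<close>; it suffices to keep \<open>z\<close> and to
  approximate \<open>x \<in> N\<^sub>C(z)\<close> from the relative interior of this cone. For \<open>g = \<delta>\<^sub>C\<close> the set
  \<open>\<partial>g\<^sup>*(z)\<close> is the face \<open>F\<close> of \<open>C\<close> exposed by \<open>z\<close>. At every relative interior point \<open>c\<close> of \<open>F\<close> one
  has \<open>span N\<^sub>C(c) = (par F)\<^sup>\<bottom>\<close> (\<open>span_normal_cone_exposed_face\<close>), and \<open>N\<^sub>C\<close> is constant on the
  relative interior of \<open>F\<close>; hence \<open>x\<close> is approximated from the relative interior of \<open>F\<close> and \<open>z\<close>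
  from the relative interior of the common normal cone.
\<close>

section \<open>Sets that locally are affine subspaces\<close>

lemma small_step_in_ball:
  fixes x c w :: "'a::real_normed_vector"
  assumes "x \<in> ball c e"
  obtains d where "d > 0" "\<And>t. 0 < t \<Longrightarrow> t \<le> d \<Longrightarrow> x + t *\<^sub>R w \<in> ball c e"
proof -
  have "((\<lambda>t. x + t *\<^sub>R w) \<longlongrightarrow> x + 0 *\<^sub>R w) (at_right 0)"
    by (intro tendsto_intros)
  then have "\<forall>\<^sub>F t in at_right 0. x + t *\<^sub>R w \<in> ball c e"
    using assms by (auto dest!: topological_tendstoD[OF _ open_ball])
  then obtain b where b: "b > 0" "\<And>t. 0 < t \<Longrightarrow> t < b \<Longrightarrow> x + t *\<^sub>R w \<in> ball c e"
    unfolding eventually_at_right_field by auto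
  show ?thesis
    by (rule that[of "b / 2"]) (use b in auto)
qed

text \<open>Near \<open>p\<close>, the set \<open>\<Omega>\<close> coincides with \<open>p + S\<close>.\<close>

definition flat_at :: "'a::real_normed_vector set \<Rightarrow> 'a \<Rightarrow> 'a set \<Rightarrow> bool" where
  "flat_at \<Omega> p S \<longleftrightarrow> (\<exists>e>0. \<forall>q\<in>ball p e. q \<in> \<Omega> \<longleftrightarrow> q - p \<in> S)"

lemma flat_at_mem:
  assumes "flat_at \<Omega> p S" "subspace S"
  shows "p \<in> \<Omega>"
  using assms unfolding flat_at_def by (metis centre_in_ball diff_self subspace_0)

lemma tangent_cone_flat:
  fixes S :: "'a::euclidean_space set"
  assumes "flat_at \<Omega> p S" "subspace S"
  shows "tangent_cone \<Omega> p = S"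
proof -
  obtain e where e: "e > 0" "\<And>q. q \<in> ball p e \<Longrightarrow> q \<in> \<Omega> \<longleftrightarrow> q - p \<in> S"
    using assms(1) unfolding flat_at_def by blast
  show ?thesis
  proof (intro set_eqI iffI)
    fix w assume "w \<in> tangent_cone \<Omega> p"
    then obtain t w' where t: "\<And>k. t k > 0" "t \<longlonglongrightarrow> (0::real)" and w': "w' \<longlonglongrightarrow> w"
      and mem: "\<And>k::nat. p + t k *\<^sub>R w' k \<in> \<Omega>"
      unfolding tangent_cone_def by blast
    have "(\<lambda>k. p + t k *\<^sub>R w' k) \<longlonglongrightarrow> p + 0 *\<^sub>R w"
      by (intro tendsto_intros t w')
    then have "\<forall>\<^sub>F k in sequentially. p + t k *\<^sub>R w' k \<in> ball p e"
      using e(1) by (auto dest!: topological_tendstoD[OF _ open_ball])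
    then have "\<forall>\<^sub>F k in sequentially. w' k \<in> S"
    proof eventually_elim
      case (elim k)
      then have "t k *\<^sub>R w' k \<in> S" using e(2)[OF elim] mem[of k] by simp
      then have "(1 / t k) *\<^sub>R (t k *\<^sub>R w' k) \<in> S"
        using assms(2) by (rule subspace_scale[rotated])
      then show ?case using t(1)[of k] by simp
    qed
    then show "w \<in> S"
      using Lim_in_closed_set[OF closed_subspace[OF assms(2)] _ _ w'] by simp
  next
    fix w assume w: "w \<in> S"
    obtain d where d: "d > 0" "\<And>t. 0 < t \<Longrightarrow> t \<le> d \<Longrightarrow> p + t *\<^sub>R w \<in> ball p e"
      using small_step_in_ball[of p p e w] e(1) by auto
    define t where "t k = d / real (Suc k)" for k
    have t0: "t k > 0" "t k \<le> d" for k
      using d(1) by (auto simp: t_def divide_simps)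
    have "p + t k *\<^sub>R w \<in> \<Omega>" for k
      using e(2)[OF d(2)[OF t0]] w assms(2) by (simp add: subspace_scale)
    moreover have "t \<longlonglongrightarrow> 0"
      unfolding t_def by (rule LIMSEQ_Suc[OF lim_const_over_n])
    ultimately show "w \<in> tangent_cone \<Omega> p"
      unfolding tangent_cone_def using t0(1) by (auto intro!: exI[of _ t] exI[of _ "\<lambda>_. w"])
  qed
qed

lemma regular_normal_cone_flat:
  assumes "flat_at \<Omega> p S"
  shows "S\<^sup>\<bottom> \<subseteq> regular_normal_cone \<Omega> p"
proof
  fix v assume v: "v \<in> S\<^sup>\<bottom>"
  obtain e where e: "e > 0" "\<And>q. q \<in> ball p e \<Longrightarrow> q \<in> \<Omega> \<longleftrightarrow> q - p \<in> S"
    using assms unfolding flat_at_def by blast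
  have "v \<bullet> (q - p) = 0" if "q \<in> \<Omega>" "dist q p < e" for q
    using that e(2)[of q] v
    by (auto simp: orthogonal_comp_def orthogonal_def inner_commute dist_commute)
  then have "\<forall>\<^sub>F q in at p within \<Omega>. ereal (v \<bullet> (q - p) / norm (q - p)) \<le> 0"
    unfolding eventually_at using e(1) by auto
  then show "v \<in> regular_normal_cone \<Omega> p"
    unfolding regular_normal_cone_def by (auto intro: Limsup_bounded)
qed

lemma orthogonal_comp_Times_subset: "(A\<^sup>\<bottom>) \<times> (B\<^sup>\<bottom>) \<subseteq> (A \<times> B)\<^sup>\<bottom>"
  by (auto simp: orthogonal_comp_def orthogonal_def)

lemma Times_orthogonal_comp_half_dim:
  fixes L :: "'a::euclidean_space set"
  assumes "subspace L"
  shows "L \<times> (L\<^sup>\<bottom>) \<in> half_dim_subspaces"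
proof -
  have "dim {y \<in> UNIV. \<forall>x \<in> L. orthogonal x y} + dim L = dim (UNIV :: 'a set)"
    by (rule dim_subspace_orthogonal_to_vectors) (use assms in auto)
  then have "dim L + dim (L\<^sup>\<bottom>) = DIM('a)"
    by (simp add: orthogonal_comp_def dim_UNIV)
  then show ?thesis
    unfolding half_dim_subspaces_def
    by (auto simp: dim_Times subspace_Times assms subspace_orthogonal_comp)
qed

lemma subspace_dist_self: "subspace_dist S S = 0"
  by (simp add: subspace_dist_def onorm_zero)

text \<open>
  The sequence defining the SC derivative may be taken with constant tangent cones, and the one
  defining the limiting normal cone with constant normals.
\<close>

lemma flat_sequence_conclusions:
  fixes L :: "'a::euclidean_space set" and p :: "nat \<Rightarrow> 'a \<times> 'a"
  assumes L: "subspace L"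
    and flat: "\<And>k. flat_at (gph F) (p k) (L \<times> (L\<^sup>\<bottom>))"
    and lim: "p \<longlonglongrightarrow> (x, z)"
  shows "(L\<^sup>\<bottom>) \<times> L \<subseteq> limiting_normal_cone (gph F) (x, z) \<and>
         L \<times> (L\<^sup>\<bottom>) \<in> SC_derivative F x z"
proof
  have half: "L \<times> (L\<^sup>\<bottom>) \<in> half_dim_subspaces"
    by (rule Times_orthogonal_comp_half_dim[OF L])
  then have S: "subspace (L \<times> (L\<^sup>\<bottom>))"
    by (simp add: half_dim_subspaces_def)
  have mem: "p k \<in> gph F" for k
    by (rule flat_at_mem[OF flat S])
  have tan: "tangent_cone (gph F) (p k) = L \<times> (L\<^sup>\<bottom>)" for k
    by (rule tangent_cone_flat[OF flat S])
  have "(L\<^sup>\<bottom>) \<times> L \<subseteq> (L \<times> (L\<^sup>\<bottom>))\<^sup>\<bottom>"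
    using orthogonal_comp_Times_subset[of L "L\<^sup>\<bottom>"] by (simp add: orthogonal_comp_self[OF L])
  then have nor: "(L\<^sup>\<bottom>) \<times> L \<subseteq> regular_normal_cone (gph F) (p k)" for k
    using regular_normal_cone_flat[OF flat] by blast
  show "(L\<^sup>\<bottom>) \<times> L \<subseteq> limiting_normal_cone (gph F) (x, z)"
  proof
    fix v assume "v \<in> (L\<^sup>\<bottom>) \<times> L"
    then show "v \<in> limiting_normal_cone (gph F) (x, z)"
      unfolding limiting_normal_cone_def using mem nor lim
      by (intro CollectI exI[of _ p] exI[of _ "\<lambda>_. v"]) (auto simp del: mem_Sigma_iff)
  qed
  show "L \<times> (L\<^sup>\<bottom>) \<in> SC_derivative F x z"
    unfolding SC_derivative_def smooth_points_def
    using half mem tan lim by (auto simp: subspace_dist_self intro!: exI[of _ p])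
qed

section \<open>The normal cone mapping of a polyhedron\<close>

text \<open>
  The normal cone of convex analysis. The base point is not required to lie in the set, so
  membership of the base point is stated separately where it matters.
\<close>

definition normal_cone :: "'a::real_inner set \<Rightarrow> 'a \<Rightarrow> 'a set" where
  "normal_cone C c = {v. \<forall>y\<in>C. v \<bullet> (y - c) \<le> 0}"

lemma normal_coneD: "v \<in> normal_cone C c \<Longrightarrow> y \<in> C \<Longrightarrow> v \<bullet> (y - c) \<le> 0"
  by (simp add: normal_cone_def)

lemma zero_in_normal_cone: "0 \<in> normal_cone C c"
  by (simp add: normal_cone_def)

lemma convex_normal_cone: "convex (normal_cone C c)"
  unfolding convex_def normal_cone_def
  by (auto simp: inner_add_left intro!: add_nonpos_nonpos mult_nonneg_nonpos)

lemma par_normal_cone: "par (normal_cone C c) = span (normal_cone C c)"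
  by (simp add: par_eq[OF zero_in_normal_cone])

lemma normal_cone_translate_subset:
  assumes "d \<in> (normal_cone C c)\<^sup>\<bottom>"
  shows "normal_cone C c \<subseteq> normal_cone C (c + d)"
proof
  fix v assume v: "v \<in> normal_cone C c"
  then have "v \<bullet> d = 0"
    using assms by (simp add: orthogonal_comp_def orthogonal_def)
  then show "v \<in> normal_cone C (c + d)"
    using v by (simp add: normal_cone_def inner_diff_right inner_add_right)
qed

text \<open>
  Near a point, a polyhedron is given by its active constraints: the witness for \<open>A\<close> consists of
  the normals of the defining halfspaces that have \<open>c\<close> on their boundary.
\<close>

lemma polyhedron_local_cone:
  fixes C :: "'a::euclidean_space set"
  assumes "polyhedron C" "c \<in> C"
  obtains e A where "e > 0" "A \<subseteq> normal_cone C c"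
    "\<And>u. u \<in> ball c e \<Longrightarrow> u \<in> C \<longleftrightarrow> (\<forall>a\<in>A. a \<bullet> (u - c) \<le> 0)"
proof -
  obtain H where H: "finite H" "C = \<Inter>H" "\<forall>h\<in>H. \<exists>a b. a \<noteq> 0 \<and> h = {x. a \<bullet> x \<le> b}"
    using assms(1) unfolding polyhedron_def by blast
  define A where "A = {a. \<exists>b. {x. a \<bullet> x \<le> b} \<in> H \<and> a \<bullet> c = b}"
  define U where "U = \<Inter> (interior ` {h \<in> H. c \<in> interior h})"
  have "open U" unfolding U_def using H(1) by (intro open_Inter) auto
  moreover have "c \<in> U" unfolding U_def by auto
  ultimately obtain e where e: "e > 0" "ball c e \<subseteq> U"
    unfolding open_contains_ball by blast
  have le: "a \<bullet> (u - c) \<le> 0" if "a \<in> A" "u \<in> C" for a u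
    using that H(2) unfolding A_def by (auto simp: inner_diff_right)
  have "u \<in> C" if u: "u \<in> ball c e" and A: "\<forall>a\<in>A. a \<bullet> (u - c) \<le> 0" for u
    unfolding H(2)
  proof
    fix h assume h: "h \<in> H"
    then obtain a b where ab: "a \<noteq> 0" "h = {x. a \<bullet> x \<le> b}" using H(3) by blast
    show "u \<in> h"
    proof (cases "c \<in> interior h")
      case True
      then have "u \<in> interior h" using u e(2) h unfolding U_def by blast
      then show ?thesis using interior_subset by blast
    next
      case False
      have "c \<in> h" using assms(2) H(2) h by blast
      with False have "a \<bullet> c = b"
        unfolding ab(2) using interior_halfspace_le[OF ab(1)] by auto
      then have "a \<in> A" using h ab unfolding A_def by blast
      then show ?thesis using A \<open>a \<bullet> c = b\<close> by (auto simp: ab(2) inner_diff_right)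
    qed
  qed
  moreover have "A \<subseteq> normal_cone C c"
    using le by (auto simp: normal_cone_def)
  ultimately show ?thesis
    using that[OF e(1), of A] le by blast
qed

text \<open>
  Outer semicontinuity of the normal cone mapping takes this strong form for polyhedra, whose
  local description by active constraints is the hypothesis. Near \<open>c\<close>, every direction \<open>y - c\<close>
  with \<open>y \<in> C\<close> is feasible at \<open>u\<close>.
\<close>

lemma normal_cone_locally_subset:
  fixes C :: "'a::euclidean_space set"
  assumes A: "A \<subseteq> normal_cone C c"
    and loc: "\<And>u. u \<in> ball c e \<Longrightarrow> u \<in> C \<longleftrightarrow> (\<forall>a\<in>A. a \<bullet> (u - c) \<le> 0)"
    and u: "u \<in> ball c e" "u \<in> C"
  shows "normal_cone C u \<subseteq> normal_cone C c"
proof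
  fix v assume v: "v \<in> normal_cone C u"
  have "v \<bullet> (y - c) \<le> 0" if y: "y \<in> C" for y
  proof -
    obtain t where t: "t > 0" "u + t *\<^sub>R (y - c) \<in> ball c e"
      using small_step_in_ball[OF u(1), of "y - c"] by (metis order_refl)
    have "a \<bullet> (u + t *\<^sub>R (y - c) - c) \<le> 0" if a: "a \<in> A" for a
    proof -
      have "a \<bullet> (u - c) \<le> 0" "a \<bullet> (y - c) \<le> 0"
        using A a normal_coneD u(2) y by blast+
      moreover have "a \<bullet> (u + t *\<^sub>R (y - c) - c) = a \<bullet> (u - c) + t * (a \<bullet> (y - c))"
        by (simp add: algebra_simps)
      ultimately show ?thesis
        using t(1) by (simp add: add_nonpos_nonpos mult_nonneg_nonpos)
    qed
    then have "u + t *\<^sub>R (y - c) \<in> C" using loc[OF t(2)] by blast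
    then have "t * (v \<bullet> (y - c)) \<le> 0" using normal_coneD[OF v] by fastforce
    then show ?thesis using t(1) by (simp add: mult_le_0_iff)
  qed
  then show "v \<in> normal_cone C c" by (simp add: normal_cone_def)
qed

lemma normal_cone_graph_flat:
  fixes C :: "'a::euclidean_space set"
  assumes C: "polyhedron C" and c: "c \<in> C"
    and v: "v \<in> rel_interior (normal_cone C c)"
    and M: "M = span (normal_cone C c)"
  shows "flat_at {(u, w). u \<in> C \<and> w \<in> normal_cone C u} (c, v) ((M\<^sup>\<bottom>) \<times> M)"
proof -
  let ?N = "normal_cone C"
  obtain e A where e: "e > 0" and A: "A \<subseteq> ?N c"
    and loc: "\<And>u. u \<in> ball c e \<Longrightarrow> u \<in> C \<longleftrightarrow> (\<forall>a\<in>A. a \<bullet> (u - c) \<le> 0)"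
    using polyhedron_local_cone[OF C c] by metis
  have "affine hull ?N c = M"
    unfolding M by (rule affine_hull_span_0) (simp add: zero_in_normal_cone hull_inc)
  then obtain r where vN: "v \<in> ?N c" and r: "r > 0" "ball v r \<inter> M \<subseteq> ?N c"
    using v unfolding mem_rel_interior_ball by auto
  have sub: "subspace M" by (simp add: M)
  have NM: "?N c \<subseteq> M" by (simp add: M span_superset)
  have "(u \<in> C \<and> w \<in> ?N u) \<longleftrightarrow> (u - c \<in> M\<^sup>\<bottom> \<and> w - v \<in> M)"
    if u: "u \<in> ball c e" and w: "w \<in> ball v r" for u w
  proof
    assume uw: "u \<in> C \<and> w \<in> ?N u"
    then have wN: "w \<in> ?N c" using normal_cone_locally_subset[OF A loc u] by blast
    have "w \<bullet> (u - c) \<le> 0" "w \<bullet> (c - u) \<le> 0"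
      using wN uw c normal_coneD by blast+
    then have w0: "w \<bullet> (u - c) = 0" by (simp add: inner_diff_right)
    have le: "m \<bullet> (u - c) \<le> 0" if m: "m \<in> M" for m
    proof -
      \<comment> \<open>\<open>w\<close> is relatively interior to the normal cone, so it can be moved along \<open>m\<close>.\<close>
      obtain t where t: "t > 0" "w + t *\<^sub>R m \<in> ball v r"
        using small_step_in_ball[OF w, of m] by (metis order_refl)
      have "w + t *\<^sub>R m \<in> M"
        using wN NM m sub by (blast intro: subspace_add subspace_scale)
      then have "w + t *\<^sub>R m \<in> ?N c" using t r by blast
      then have "t * (m \<bullet> (u - c)) \<le> 0"
        using normal_coneD[of _ C c u] uw w0 by (fastforce simp: inner_add_left)
      then show ?thesis using t(1) by (simp add: mult_le_0_iff)
    qed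
    have "m \<bullet> (u - c) = 0" if m: "m \<in> M" for m
      using le[OF m] le[OF subspace_neg[OF sub m]] by simp
    then show "u - c \<in> M\<^sup>\<bottom> \<and> w - v \<in> M"
      using wN vN NM sub by (auto simp: orthogonal_comp_def orthogonal_def intro: subspace_diff)
  next
    assume uw: "u - c \<in> M\<^sup>\<bottom> \<and> w - v \<in> M"
    have perp: "u - c \<in> (?N c)\<^sup>\<bottom>"
      using uw orthogonal_comp_anti_mono[OF NM] by blast
    then have "\<forall>a\<in>A. a \<bullet> (u - c) = 0"
      using A by (auto simp: orthogonal_comp_def orthogonal_def)
    then have "u \<in> C" using loc[OF u] by simp
    have "v + (w - v) \<in> M" using uw vN NM sub by (blast intro: subspace_add)
    then have "w \<in> ?N c" using w r by auto
    then have "w \<in> ?N u" using normal_cone_translate_subset[OF perp] by auto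
    with \<open>u \<in> C\<close> show "u \<in> C \<and> w \<in> ?N u" by blast
  qed
  moreover have "fst q \<in> ball c e \<and> snd q \<in> ball v r" if "q \<in> ball (c, v) (min e r)" for q
    using that dist_fst_le[of "(c, v)" q] dist_snd_le[of "(c, v)" q] by auto
  ultimately show ?thesis
    unfolding flat_at_def using e r(1)
    by (intro exI[of _ "min e r"]) (auto simp: split_beta mem_Times_iff simp del: mem_ball)
qed

lemma flat_at_swap:
  assumes "flat_at {(u, w). P u w} (c, v) (S \<times> T)"
  shows "flat_at {(w, u). P u w} (v, c) (T \<times> S)"
proof -
  obtain e where e: "e > 0"
    "\<forall>q\<in>ball (c, v) e. q \<in> {(u, w). P u w} \<longleftrightarrow> q - (c, v) \<in> S \<times> T"
    using assms unfolding flat_at_def by (elim exE conjE) (rule that)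
  have "P u w \<longleftrightarrow> w - v \<in> T \<and> u - c \<in> S" if "(w, u) \<in> ball (v, c) e" for u w
    using e(2)[THEN bspec, of "(u, w)"] that by (auto simp: dist_Pair_Pair add.commute)
  then show ?thesis
    unfolding flat_at_def using e(1) by (intro exI[of _ e]) auto
qed

text \<open>
  At a relative interior point of an exposed face, the normal cone spans the orthogonal
  complement of the directions of the face. The inclusion from right to left uses polyhedrality:
  a direction orthogonal to the normal cone can be followed without leaving \<open>C\<close>.
\<close>

lemma span_normal_cone_exposed_face:
  fixes C :: "'a::euclidean_space set"
  assumes C: "polyhedron C"
    and F: "F = {y \<in> C. z \<in> normal_cone C y}" and cF: "convex F"
    and c: "c \<in> rel_interior F"
  shows "span (normal_cone C c) = (par F)\<^sup>\<bottom>"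
proof
  let ?N = "normal_cone C c"
  have cinF: "c \<in> F" using c rel_interior_subset by blast
  then have cC: "c \<in> C" and zN: "z \<in> ?N" by (auto simp: F)
  have par: "par F = span ((\<lambda>y. y - c) ` F)" by (rule par_eq[OF cinF])
  have "v \<bullet> (y - c) = 0" if v: "v \<in> ?N" and y: "y \<in> F" for v y
  proof -
    obtain s where s: "s > 1" "(1 - s) *\<^sub>R y + s *\<^sub>R c \<in> F"
      using c y convex_rel_interior_iff[OF cF, of c] cinF by blast
    then have "v \<bullet> ((1 - s) *\<^sub>R y + s *\<^sub>R c - c) \<le> 0"
      using normal_coneD[OF v] by (auto simp: F)
    moreover have "(1 - s) *\<^sub>R y + s *\<^sub>R c - c = (1 - s) *\<^sub>R (y - c)"
      by (simp add: algebra_simps)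
    ultimately have "(1 - s) * (v \<bullet> (y - c)) \<le> 0" by simp
    then have "v \<bullet> (y - c) \<ge> 0" using s(1) by (simp add: mult_le_0_iff)
    moreover have "v \<bullet> (y - c) \<le> 0" using normal_coneD[OF v] y by (simp add: F)
    ultimately show ?thesis by simp
  qed
  then have "(\<lambda>y. y - c) ` F \<subseteq> ?N\<^sup>\<bottom>"
    by (auto simp: orthogonal_comp_def orthogonal_def)
  then have "par F \<subseteq> ?N\<^sup>\<bottom>"
    unfolding par by (rule span_minimal) (rule subspace_orthogonal_comp)
  then have "?N \<subseteq> (par F)\<^sup>\<bottom>"
    using orthogonal_comp_anti_mono orthogonal_comp_subset by blast
  then show "span ?N \<subseteq> (par F)\<^sup>\<bottom>"
    by (rule span_minimal) (rule subspace_orthogonal_comp)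
  obtain e A where e: "e > 0" and A: "A \<subseteq> ?N"
    and loc: "\<And>u. u \<in> ball c e \<Longrightarrow> u \<in> C \<longleftrightarrow> (\<forall>a\<in>A. a \<bullet> (u - c) \<le> 0)"
    using polyhedron_local_cone[OF C cC] by metis
  have "(span ?N)\<^sup>\<bottom> \<subseteq> par F"
  proof
    fix d assume "d \<in> (span ?N)\<^sup>\<bottom>"
    then have d: "d \<in> ?N\<^sup>\<bottom>" using orthogonal_comp_anti_mono[OF span_superset] by blast
    obtain t where t: "t > 0" "c + t *\<^sub>R d \<in> ball c e"
      using small_step_in_ball[of c c e d] e by (metis order_refl centre_in_ball)
    have td: "t *\<^sub>R d \<in> ?N\<^sup>\<bottom>" using d by (simp add: subspace_scale subspace_orthogonal_comp)
    have "\<forall>a\<in>A. a \<bullet> (t *\<^sub>R d) = 0"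
      using td A unfolding orthogonal_comp_def orthogonal_def by blast
    then have "c + t *\<^sub>R d \<in> C" using loc[OF t(2)] by (metis add_diff_cancel_left' order_refl)
    moreover have "z \<in> normal_cone C (c + t *\<^sub>R d)"
      using normal_cone_translate_subset[OF td] zN by blast
    ultimately have "c + t *\<^sub>R d \<in> F" by (simp add: F)
    then have "(c + t *\<^sub>R d) - c \<in> par F" unfolding par by (intro span_base imageI)
    then have "t *\<^sub>R d \<in> par F" by simp
    then have "(1 / t) *\<^sub>R (t *\<^sub>R d) \<in> par F" unfolding par by (rule span_scale)
    then show "d \<in> par F" using t(1) by simp
  qed
  then have "(par F)\<^sup>\<bottom> \<subseteq> (span ?N)\<^sup>\<bottom>\<^sup>\<bottom>" by (rule orthogonal_comp_anti_mono)
  then show "(par F)\<^sup>\<bottom> \<subseteq> span ?N" by (simp add: orthogonal_comp_self)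
qed

section \<open>Indicator and support functions\<close>

lemma subdifferential_indicator_fun:
  "subdifferential (indicator_fun C) x = (if x \<in> C then normal_cone C x else {})"
  by (auto simp: subdifferential_def indicator_fun_def normal_cone_def)

lemma conjugate_indicator_fun: "conjugate (indicator_fun C) = support_fun C"
proof
  fix v
  show "conjugate (indicator_fun C) v = support_fun C v"
    unfolding conjugate_def support_fun_def indicator_fun_def
    by (intro antisym SUP_least) (auto intro: SUP_upper2 simp: zero_ereal_def)
qed

lemma inner_le_support_fun: "y \<in> C \<Longrightarrow> ereal (v \<bullet> y) \<le> support_fun C v"
  unfolding support_fun_def by (rule SUP_upper)

lemma support_fun_zero: "C \<noteq> {} \<Longrightarrow> support_fun C 0 = 0"
  unfolding support_fun_def by (simp add: zero_ereal_def)

lemma support_fun_eq: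
  assumes "c \<in> C" "v \<in> normal_cone C c"
  shows "support_fun C v = ereal (v \<bullet> c)"
proof (rule antisym)
  show "support_fun C v \<le> ereal (v \<bullet> c)"
    unfolding support_fun_def
    using assms(2) by (auto intro!: SUP_least simp: normal_cone_def inner_diff_right)
qed (rule inner_le_support_fun[OF assms(1)])

lemma strict_separation_support:
  fixes C :: "'a::euclidean_space set"
  assumes "convex C" "closed C" "z \<notin> C"
  obtains w b where "w \<bullet> z > b" "\<And>y. y \<in> C \<Longrightarrow> w \<bullet> y \<le> b"
proof -
  obtain a b where "a \<bullet> z < b" "\<forall>y\<in>C. a \<bullet> y > b"
    using separating_hyperplane_closed_point[OF assms] by blast
  then show ?thesis using that[of "- b" "- a"] by fastforce
qed

lemma mem_subdifferential_support_fun: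
  fixes C :: "'a::euclidean_space set"
  assumes C: "convex C" "closed C"
  shows "z \<in> subdifferential (support_fun C) x \<longleftrightarrow> z \<in> C \<and> x \<in> normal_cone C z"
proof
  assume "z \<in> subdifferential (support_fun C) x"
  then have fin: "\<bar>support_fun C x\<bar> \<noteq> \<infinity>"
    and le: "\<And>y. support_fun C x + ereal (z \<bullet> (y - x)) \<le> support_fun C y"
    by (auto simp: subdifferential_def)
  obtain r where r: "support_fun C x = ereal r" using fin by auto
  have max: "x \<bullet> y \<le> r" if "y \<in> C" for y
    using inner_le_support_fun[OF that, of x] r by simp
  have ne: "C \<noteq> {}"
    using fin by (auto simp: support_fun_def bot_ereal_def)
  have zC: "z \<in> C"
  proof (rule ccontr)
    assume "z \<notin> C"
    then obtain w b where w: "w \<bullet> z > b" "\<And>y. y \<in> C \<Longrightarrow> w \<bullet> y \<le> b"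
      using strict_separation_support[OF C] by metis
    \<comment> \<open>Subadditivity: \<open>\<sigma>(x + w) \<le> \<sigma>(x) + b\<close>, whereas the subgradient inequality at \<open>x + w\<close>
       gives \<open>\<sigma>(x) + w \<bullet> z \<le> \<sigma>(x + w)\<close>.\<close>
    have "support_fun C (x + w) \<le> ereal (r + b)"
      unfolding support_fun_def
      using max w(2) by (auto intro!: SUP_least add_mono simp: inner_add_left)
    then have "ereal (r + z \<bullet> w) \<le> ereal (r + b)"
      using le[of "x + w"] r order_trans by fastforce
    then show False using w(1) by (simp add: inner_commute)
  qed
  have "r \<le> x \<bullet> z"
    using le[of 0] r support_fun_zero[OF ne] by (simp add: inner_commute zero_ereal_def)
  then have "x \<in> normal_cone C z"
    using max by (fastforce simp: normal_cone_def inner_diff_right)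
  with zC show "z \<in> C \<and> x \<in> normal_cone C z" by blast
next
  assume zx: "z \<in> C \<and> x \<in> normal_cone C z"
  then have eq: "support_fun C x = ereal (x \<bullet> z)" using support_fun_eq by blast
  have "support_fun C x + ereal (z \<bullet> (y - x)) \<le> support_fun C y" for y
    using inner_le_support_fun[of z C y] zx unfolding eq
    by (simp add: inner_diff_right inner_commute)
  then show "z \<in> subdifferential (support_fun C) x"
    by (simp add: subdifferential_def eq)
qed

lemma conjugate_support_fun:
  fixes C :: "'a::euclidean_space set"
  assumes C: "convex C" "closed C" and ne: "C \<noteq> {}"
  shows "conjugate (support_fun C) = indicator_fun C"
proof
  fix v
  show "conjugate (support_fun C) v = indicator_fun C v"
  proof (cases "v \<in> C")
    case True
    have "ereal (v \<bullet> x) - support_fun C x \<le> 0" for x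
      using inner_le_support_fun[OF True, of x]
      by (cases "support_fun C x") (auto simp: inner_commute zero_ereal_def)
    moreover have "ereal (v \<bullet> 0) - support_fun C 0 = 0"
      by (simp add: support_fun_zero[OF ne])
    ultimately have "conjugate (support_fun C) v = 0"
      unfolding conjugate_def by (intro antisym SUP_least SUP_upper2[of 0]) simp_all
    then show ?thesis using True by (simp add: indicator_fun_def)
  next
    case False
    then obtain w b where w: "w \<bullet> v > b" "\<And>y. y \<in> C \<Longrightarrow> w \<bullet> y \<le> b"
      using strict_separation_support[OF C] by metis
    have "ereal B \<le> conjugate (support_fun C) v" for B
    proof -
      \<comment> \<open>Scaling \<open>w\<close> makes the gap \<open>v \<bullet> w - b\<close> exceed any bound.\<close>
      define t where "t = max 0 (B / (w \<bullet> v - b))"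
      have t: "t \<ge> 0" "t * (w \<bullet> v - b) \<ge> B"
        using w(1) by (auto simp: t_def max_def divide_simps split: if_splits)
      have "support_fun C (t *\<^sub>R w) \<le> ereal (t * b)"
        unfolding support_fun_def
        using w(2) t(1) by (auto intro!: SUP_least mult_left_mono)
      then have "ereal (v \<bullet> (t *\<^sub>R w)) - ereal (t * b)
                   \<le> ereal (v \<bullet> (t *\<^sub>R w)) - support_fun C (t *\<^sub>R w)"
        by (intro ereal_minus_mono) auto
      also have "\<dots> \<le> conjugate (support_fun C) v"
        unfolding conjugate_def by (rule SUP_upper) simp
      finally have "ereal (t * (w \<bullet> v - b)) \<le> conjugate (support_fun C) v"
        by (simp add: algebra_simps inner_commute)
      then show ?thesis using t(2) by (metis ereal_less_eq(3) order_trans)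
    qed
    then have "conjugate (support_fun C) v = \<infinity>" by (rule ereal_top)
    then show ?thesis using False by (simp add: indicator_fun_def)
  qed
qed

section \<open>The two graphs\<close>

lemma relative_interior_sequence:
  fixes x c :: "'a::euclidean_space"
  assumes "convex S" "c \<in> rel_interior S" "x \<in> S"
  shows "x - inverse (real (Suc k)) *\<^sub>R (x - c) \<in> rel_interior S"
    and "(\<lambda>k. x - inverse (real (Suc k)) *\<^sub>R (x - c)) \<longlonglongrightarrow> x"
proof -
  show "x - inverse (real (Suc k)) *\<^sub>R (x - c) \<in> rel_interior S"
    by (rule rel_interior_convex_shrink[OF assms]) (auto simp: divide_simps)
  have "(\<lambda>k. x - inverse (real (Suc k)) *\<^sub>R (x - c)) \<longlonglongrightarrow> x - 0 *\<^sub>R (x - c)"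
    by (intro tendsto_intros LIMSEQ_inverse_real_of_nat)
  then show "(\<lambda>k. x - inverse (real (Suc k)) *\<^sub>R (x - c)) \<longlonglongrightarrow> x" by simp
qed

lemma obtain_relative_interior_sequence:
  fixes x :: "'a::euclidean_space"
  assumes "convex S" "x \<in> S"
  obtains s where "\<And>k::nat. s k \<in> rel_interior S" "s \<longlonglongrightarrow> x"
proof -
  obtain c where c: "c \<in> rel_interior S"
    using assms rel_interior_eq_empty by blast
  note seq = relative_interior_sequence[OF assms(1) c assms(2)]
  show ?thesis
    by (rule that[OF seq])
qed

lemma indicator_fun_case:
  fixes C :: "'a::euclidean_space set"
  assumes C: "polyhedron C"
    and xz: "(x, z) \<in> gph (subdifferential (indicator_fun C))"
    and L: "L = par (subdifferential (conjugate (indicator_fun C)) z)"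
  shows "(L\<^sup>\<bottom>) \<times> L \<subseteq> limiting_normal_cone (gph (subdifferential (indicator_fun C))) (x, z) \<and>
         L \<times> (L\<^sup>\<bottom>) \<in> SC_derivative (subdifferential (indicator_fun C)) x z"
proof -
  let ?N = "normal_cone C"
  have cl: "convex C" "closed C"
    using C by (auto simp: polyhedron_imp_convex polyhedron_imp_closed)
  have xC: "x \<in> C" and zN: "z \<in> ?N x"
    using xz by (auto simp: gph_def subdifferential_indicator_fun split: if_splits)
  have G: "gph (subdifferential (indicator_fun C)) = {(u, w). u \<in> C \<and> w \<in> ?N u}"
    by (auto simp: gph_def subdifferential_indicator_fun split: if_splits)
  define F where "F = {y \<in> C. z \<in> ?N y}"
  have LF: "L = par F"
    unfolding L conjugate_indicator_fun F_def
    by (rule arg_cong[where f = par]) (auto simp: mem_subdifferential_support_fun[OF cl])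
  have xF: "x \<in> F" using xC zN by (simp add: F_def)
  have "F = C \<inter> {y. z \<bullet> x \<le> z \<bullet> y}"
    using xC zN by (fastforce simp: F_def normal_cone_def inner_diff_right)
  then have cF: "convex F"
    using cl(1) convex_halfspace_ge[of "z \<bullet> x" z] by (simp add: convex_Int)
  obtain s where s: "\<And>k::nat. s k \<in> rel_interior F" "s \<longlonglongrightarrow> x"
    using obtain_relative_interior_sequence[OF cF xF] by metis
  have sF: "s k \<in> F" for k using s(1) rel_interior_subset by blast
  have sub: "subspace L" by (simp add: LF par_eq[OF xF])
  have span: "span (?N (s k)) = L\<^sup>\<bottom>" for k
    unfolding LF by (rule span_normal_cone_exposed_face[OF C F_def cF s(1)])
  have Nsub: "?N (s j) \<subseteq> ?N (s k)" for j k
  proof -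
    have "s k - s j \<in> L" unfolding LF par_eq[OF sF[of j]] by (intro span_base imageI sF)
    then have "s k - s j \<in> (span (?N (s j)))\<^sup>\<bottom>" by (simp add: span orthogonal_comp_self[OF sub])
    then have "s k - s j \<in> (?N (s j))\<^sup>\<bottom>" using orthogonal_comp_anti_mono[OF span_superset] by blast
    then show ?thesis using normal_cone_translate_subset by fastforce
  qed
  have "z \<in> ?N (s 0)" using sF by (simp add: F_def)
  then obtain w where w: "\<And>k::nat. w k \<in> rel_interior (?N (s 0))" "w \<longlonglongrightarrow> z"
    using obtain_relative_interior_sequence[OF convex_normal_cone] by metis
  have "flat_at (gph (subdifferential (indicator_fun C))) (s k, w k) (L \<times> (L\<^sup>\<bottom>))" for k
  proof -
    have "?N (s k) = ?N (s 0)" using Nsub by blast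
    then have "w k \<in> rel_interior (?N (s k))" using w(1) by simp
    moreover have "s k \<in> C" using sF by (simp add: F_def)
    ultimately show ?thesis
      unfolding G using normal_cone_graph_flat[OF C, of "s k" "w k" "L\<^sup>\<bottom>"]
      by (simp add: span orthogonal_comp_self[OF sub])
  qed
  then show ?thesis
    by (rule flat_sequence_conclusions[OF sub _ tendsto_Pair[OF s(2) w(2)]])
qed

lemma support_fun_case:
  fixes C :: "'a::euclidean_space set"
  assumes C: "polyhedron C"
    and xz: "(x, z) \<in> gph (subdifferential (support_fun C))"
    and L: "L = par (subdifferential (conjugate (support_fun C)) z)"
  shows "(L\<^sup>\<bottom>) \<times> L \<subseteq> limiting_normal_cone (gph (subdifferential (support_fun C))) (x, z) \<and>
         L \<times> (L\<^sup>\<bottom>) \<in> SC_derivative (subdifferential (support_fun C)) x z"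
proof -
  let ?N = "normal_cone C"
  have cl: "convex C" "closed C"
    using C by (auto simp: polyhedron_imp_convex polyhedron_imp_closed)
  have G: "gph (subdifferential (support_fun C)) = {(w, u). u \<in> C \<and> w \<in> ?N u}"
    by (auto simp: gph_def mem_subdifferential_support_fun[OF cl])
  have zC: "z \<in> C" and xN: "x \<in> ?N z" using xz unfolding G by auto
  have LN: "L = span (?N z)"
    using zC conjugate_support_fun[OF cl] unfolding L
    by (metis empty_iff par_normal_cone subdifferential_indicator_fun)
  have sub: "subspace L" by (simp add: LN)
  obtain w where w: "\<And>k::nat. w k \<in> rel_interior (?N z)" "w \<longlonglongrightarrow> x"
    using obtain_relative_interior_sequence[OF convex_normal_cone xN] by metis
  have "flat_at (gph (subdifferential (support_fun C))) (w k, z) (L \<times> (L\<^sup>\<bottom>))" for k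
    unfolding G by (rule flat_at_swap[OF normal_cone_graph_flat[OF C zC w(1) LN]])
  then show ?thesis
    by (rule flat_sequence_conclusions[OF sub _ tendsto_Pair[OF w(2) tendsto_const]])
qed

theorem proposition3p6:
  fixes C :: "'a::euclidean_space set"
    and g :: "'a \<Rightarrow> ereal"
    and x z :: 'a
    and L :: "'a set"
  assumes "polyhedron C"
    and "g = indicator_fun C \<or> g = support_fun C"
    and "(x, z) \<in> gph (subdifferential g)"
    and "L = par (subdifferential (conjugate g) z)"
  shows "(L\<^sup>\<bottom>) \<times> L \<subseteq> limiting_normal_cone (gph (subdifferential g)) (x, z) \<and>
         L \<times> (L\<^sup>\<bottom>) \<in> SC_derivative (subdifferential g) x z"
  using assms(2)
proof
  assume "g = indicator_fun C"
  then show ?thesis using indicator_fun_case assms by blast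
next
  assume "g = support_fun C"
  then show ?thesis using support_fun_case assms by blast
qed

end
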